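(* Let $\sigma$ be a finite signature. For any fuzzy formula $F$ of $\sigma$ that may contain strong negation (in front of atoms), whose only fuzzy negation operator is $\neg_s(x)=1-x$, a valuation $V$ of $\sigma$ is a fuzzy equilibrium model of $F$ if and only if $nneg(V)$ is a fuzzy equilibrium model of $nneg(F)$.
   Context: Fuzzy formulas. A signature $\sigma$ is a set of symbols (fuzzy atoms). Fuzzy formulas are built from atoms of $\sigma$ and numeric constants $c\in[0,1]$ using the fuzzy negation $\neg=\neg_s$, $\neg_s(x)=1-x$, fuzzy conjunctions $\otimes$, disjunctions $\oplus$ and implications $\rightarrow$ (several different ones may occur), identified with functions $[0,1]^2\to[0,1]$ such that (monotonicity being non-strict): $\otimes$ is increasing in both arguments, commutative, associative, $\otimes(1,x)=x$; $\oplus$ is increasing in both arguments, commutative, associative, $\oplus(0,x)=x$; $\rightarrow$ is decreasing in its first and increasing in its second argument, $\rightarrow\!(1,x)=x$, $\rightarrow\!(0,0)=1$. Formulas with strong negation may additionally contain subformulas $\sim\! a$ with $a$ an atom. $\otimes_m(x,y)=\min(x,y)$, $\otimes_l(x,y)=\max(x+y-1,0)$. Infix notation is used for values as well. Fuzzy equilibrium logic. A (fuzzy N5) valuation $V$ of $\sigma$ maps $\{h,t\}\times\sigma$ to closed subintervals of $[0,1]$ with $V(t,a)\subseteq V(h,a)$ for each $a\in\sigma$. $V^-$ and $V^+$ denote lower and upper bounds of the interval. $V$ is extended to formulas ($w\in\{h,t\}$) by: $V(w,c)=[c,c]$; $V(w,\sim\! a)=[1-V^+(w,a),\,1-V^-(w,a)]$;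 $V(w,F\odot G)=[V^-(w,F)\odot V^-(w,G),\,V^+(w,F)\odot V^+(w,G)]$ for $\odot\in\{\otimes,\oplus\}$; $V(h,\neg F)=[1-V^-(t,F),\,1-V^-(h,F)]$; $V(t,\neg F)=[1-V^-(t,F),\,1-V^-(t,F)]$; $V(h,F\rightarrow G)=[\min(V^-(h,F)\rightarrow V^-(h,G),\,V^-(t,F)\rightarrow V^-(t,G)),\ V^-(h,F)\rightarrow V^+(h,G)]$; $V(t,F\rightarrow G)=[V^-(t,F)\rightarrow V^-(t,G),\,V^-(t,F)\rightarrow V^+(t,G)]$. $V$ is a model of $F$ if $V^-(h,F)=1$. $V'\preceq V$ means $V'(t,a)=V(t,a)$ and $V(h,a)\subseteq V'(h,a)$ for all atoms $a$; $V'\prec V$ means $V'\preceq V$ and $V'\ne V$. A model $V$ of $F$ is h-minimal if there is no model $V'$ of $F$ with $V'\prec V$. A fuzzy equilibrium model of $F$ is an h-minimal model $V$ of $F$ with $V(h,a)=V(t,a)$ for all atoms $a$. Elimination of strong negation. For each $p\in\sigma$, $np$ is a new atom. $F'$ is obtained from $F$ by replacing every strongly negated atom $\sim\! p$ with $np$, and $nneg(F)=F'\otimes_m\bigotimes_{m,\,p\in\sigma}\neg_s(p\otimes_l np)$ (the second part is the $\otimes_m$-conjunction over all $p\in\sigma$), a formula of $\sigma\cup\{np\mid p\in\sigma\}$. For a valuation $V$ of $\sigma$, $nneg(V)$ is the valuation of $\sigma\cup\{np\mid p\in\sigma\}$ with $nneg(V)(w,p)=[V^-(w,p),1]$ and $nneg(V)(w,np)=[1-V^+(w,p),1]$.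 *)

theory Defs
  imports "HOL-Library.Interval"
begin

section \<open>Fuzzy operators\<close>

text \<open>
  Operators \<open>[0,1]\<^sup>2 \<rightarrow> [0,1]\<close> are represented by functions on the reals that preserve the unit
  interval; their values outside it are irrelevant.
\<close>

definition unit_operator :: "(real \<Rightarrow> real \<Rightarrow> real) \<Rightarrow> bool" where
  "unit_operator f \<longleftrightarrow> (\<forall>x\<in>{0..1}. \<forall>y\<in>{0..1}. f x y \<in> {0..1})"

definition fuzzy_conjunction :: "(real \<Rightarrow> real \<Rightarrow> real) \<Rightarrow> bool" where
  "fuzzy_conjunction f \<longleftrightarrow> unit_operator f
    \<and> (\<forall>y\<in>{0..1}. mono_on {0..1} (\<lambda>x. f x y)) \<and> (\<forall>x\<in>{0..1}. mono_on {0..1} (f x))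
    \<and> (\<forall>x\<in>{0..1}. \<forall>y\<in>{0..1}. f x y = f y x)
    \<and> (\<forall>x\<in>{0..1}. \<forall>y\<in>{0..1}. \<forall>z\<in>{0..1}. f (f x y) z = f x (f y z))
    \<and> (\<forall>x\<in>{0..1}. f 1 x = x)"

definition fuzzy_disjunction :: "(real \<Rightarrow> real \<Rightarrow> real) \<Rightarrow> bool" where
  "fuzzy_disjunction f \<longleftrightarrow> unit_operator f
    \<and> (\<forall>y\<in>{0..1}. mono_on {0..1} (\<lambda>x. f x y)) \<and> (\<forall>x\<in>{0..1}. mono_on {0..1} (f x))
    \<and> (\<forall>x\<in>{0..1}. \<forall>y\<in>{0..1}. f x y = f y x)
    \<and> (\<forall>x\<in>{0..1}. \<forall>y\<in>{0..1}. \<forall>z\<in>{0..1}. f (f x y) z = f x (f y z))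
    \<and> (\<forall>x\<in>{0..1}. f 0 x = x)"

definition fuzzy_implication :: "(real \<Rightarrow> real \<Rightarrow> real) \<Rightarrow> bool" where
  "fuzzy_implication f \<longleftrightarrow> unit_operator f
    \<and> (\<forall>y\<in>{0..1}. antimono_on {0..1} (\<lambda>x. f x y)) \<and> (\<forall>x\<in>{0..1}. mono_on {0..1} (f x))
    \<and> (\<forall>x\<in>{0..1}. f 1 x = x) \<and> f 0 0 = 1"

definition conj_luk :: "real \<Rightarrow> real \<Rightarrow> real" where
  "conj_luk x y = max (x + y - 1) 0"


section \<open>Formulas\<close>

text \<open>
  Binary connectives carry the operator that interprets them, so different conjunctions,
  disjunctions and implications may occur in one formula. \<open>Neg\<close> always stands for
  \<open>x \<mapsto> 1 - x\<close>; \<open>SNeg p\<close> is the strongly negated atom \<open>\<sim> p\<close>.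
\<close>

datatype 'a form =
    Atom 'a
  | SNeg 'a
  | Const real
  | Neg "'a form"
  | Conj "real \<Rightarrow> real \<Rightarrow> real" "'a form" "'a form"
  | Disj "real \<Rightarrow> real \<Rightarrow> real" "'a form" "'a form"
  | Imp "real \<Rightarrow> real \<Rightarrow> real" "'a form" "'a form"

primrec fuzzy_formula :: "'a set \<Rightarrow> 'a form \<Rightarrow> bool" where
  "fuzzy_formula \<sigma> (Atom a) \<longleftrightarrow> a \<in> \<sigma>"
| "fuzzy_formula \<sigma> (SNeg a) \<longleftrightarrow> a \<in> \<sigma>"
| "fuzzy_formula \<sigma> (Const c) \<longleftrightarrow> c \<in> {0..1}"
| "fuzzy_formula \<sigma> (Neg F) \<longleftrightarrow> fuzzy_formula \<sigma> F"
| "fuzzy_formula \<sigma> (Conj f F G) \<longleftrightarrow> fuzzy_conjunction f \<and> fuzzy_formula \<sigma> F \<and> fuzzy_formula \<sigma> G"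
| "fuzzy_formula \<sigma> (Disj f F G) \<longleftrightarrow> fuzzy_disjunction f \<and> fuzzy_formula \<sigma> F \<and> fuzzy_formula \<sigma> G"
| "fuzzy_formula \<sigma> (Imp f F G) \<longleftrightarrow> fuzzy_implication f \<and> fuzzy_formula \<sigma> F \<and> fuzzy_formula \<sigma> G"


section \<open>Fuzzy N5 valuations\<close>

datatype world = H | T

type_synonym 'a valuation = "world \<Rightarrow> 'a \<Rightarrow> real interval"

text \<open>
  Valuations are total functions on the atom type; only their values on the signature \<open>\<sigma>\<close> matter,
  and all notions below compare valuations on \<open>\<sigma>\<close> only.
\<close>

definition is_valuation :: "'a set \<Rightarrow> 'a valuation \<Rightarrow> bool" where
  "is_valuation \<sigma> V \<longleftrightarrow>
     (\<forall>w. \<forall>a\<in>\<sigma>. set_of (V w a) \<subseteq> {0..1}) \<and> (\<forall>a\<in>\<sigma>. set_of (V T a) \<subseteq> set_of (V H a))"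

text \<open>
  \<open>Interval (l, u)\<close> is meaningful only for \<open>l \<le> u\<close>; lemma \<open>bounds_val\<close> below shows that this
  holds whenever a formula of \<open>\<sigma>\<close> is evaluated under a valuation of \<open>\<sigma>\<close>.
\<close>

fun val :: "'a valuation \<Rightarrow> world \<Rightarrow> 'a form \<Rightarrow> real interval" where
  "val V w (Atom a) = V w a"
| "val V w (SNeg a) = Interval (1 - upper (V w a), 1 - lower (V w a))"
| "val V w (Const c) = Interval (c, c)"
| "val V w (Conj f F G) =
     Interval (f (lower (val V w F)) (lower (val V w G)), f (upper (val V w F)) (upper (val V w G)))"
| "val V w (Disj f F G) =
     Interval (f (lower (val V w F)) (lower (val V w G)), f (upper (val V w F)) (upper (val V w G)))"
| "val V H (Neg F) = Interval (1 - lower (val V T F), 1 - lower (val V H F))"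
| "val V T (Neg F) = Interval (1 - lower (val V T F), 1 - lower (val V T F))"
| "val V H (Imp f F G) =
     Interval (min (f (lower (val V H F)) (lower (val V H G))) (f (lower (val V T F)) (lower (val V T G))),
               f (lower (val V H F)) (upper (val V H G)))"
| "val V T (Imp f F G) =
     Interval (f (lower (val V T F)) (lower (val V T G)), f (lower (val V T F)) (upper (val V T G)))"


section \<open>Fuzzy equilibrium models\<close>

definition is_model :: "'a set \<Rightarrow> 'a form \<Rightarrow> 'a valuation \<Rightarrow> bool" where
  "is_model \<sigma> F V \<longleftrightarrow> is_valuation \<sigma> V \<and> lower (val V H F) = 1"

definition val_preceq :: "'a set \<Rightarrow> 'a valuation \<Rightarrow> 'a valuation \<Rightarrow> bool" where
  "val_preceq \<sigma> V' V \<longleftrightarrow> (\<forall>a\<in>\<sigma>. V' T a = V T a \<and> set_of (V H a) \<subseteq> set_of (V' H a))"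

definition val_prec :: "'a set \<Rightarrow> 'a valuation \<Rightarrow> 'a valuation \<Rightarrow> bool" where
  "val_prec \<sigma> V' V \<longleftrightarrow> val_preceq \<sigma> V' V \<and> (\<exists>w. \<exists>a\<in>\<sigma>. V' w a \<noteq> V w a)"

definition h_minimal_model :: "'a set \<Rightarrow> 'a form \<Rightarrow> 'a valuation \<Rightarrow> bool" where
  "h_minimal_model \<sigma> F V \<longleftrightarrow> is_model \<sigma> F V \<and> \<not> (\<exists>V'. is_model \<sigma> F V' \<and> val_prec \<sigma> V' V)"

definition equilibrium_model :: "'a set \<Rightarrow> 'a form \<Rightarrow> 'a valuation \<Rightarrow> bool" where
  "equilibrium_model \<sigma> F V \<longleftrightarrow> h_minimal_model \<sigma> F V \<and> (\<forall>a\<in>\<sigma>. V H a = V T a)"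


section \<open>Elimination of strong negation\<close>

text \<open>
  The signature extended by a new atom \<open>np\<close> for each \<open>p \<in> \<sigma>\<close> is the disjoint sum \<open>\<sigma> <+> \<sigma>\<close>:
  \<open>Inl p\<close> is the old atom \<open>p\<close> and \<open>Inr p\<close> is the new atom \<open>np\<close>.
\<close>

primrec elim_sneg :: "'a form \<Rightarrow> ('a + 'a) form" where
  "elim_sneg (Atom p) = Atom (Inl p)"
| "elim_sneg (SNeg p) = Atom (Inr p)"
| "elim_sneg (Const c) = Const c"
| "elim_sneg (Neg F) = Neg (elim_sneg F)"
| "elim_sneg (Conj f F G) = Conj f (elim_sneg F) (elim_sneg G)"
| "elim_sneg (Disj f F G) = Disj f (elim_sneg F) (elim_sneg G)"
| "elim_sneg (Imp f F G) = Imp f (elim_sneg F) (elim_sneg G)"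

text \<open>The empty conjunction (which arises for the empty signature only) is the neutral element.\<close>

fun big_conj_min :: "'a form list \<Rightarrow> 'a form" where
  "big_conj_min [] = Const 1"
| "big_conj_min [F] = F"
| "big_conj_min (F # Fs) = Conj min F (big_conj_min Fs)"

text \<open>
  A conjunction over a finite signature is syntactically determined only once the atoms are
  listed in some order; \<open>ps\<close> is an enumeration of the signature.
\<close>

definition nneg :: "'a list \<Rightarrow> 'a form \<Rightarrow> ('a + 'a) form" where
  "nneg ps F = Conj min (elim_sneg F)
     (big_conj_min (map (\<lambda>p. Neg (Conj conj_luk (Atom (Inl p)) (Atom (Inr p)))) ps))"

definition nneg_valuation :: "'a valuation \<Rightarrow> ('a + 'a) valuation" where
  "nneg_valuation V w x =
     (case x of Inl p \<Rightarrow> Interval (lower (V w p), 1) | Inr p \<Rightarrow> Interval (1 - upper (V w p), 1))"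


section \<open>Well-definedness\<close>

lemma bounds_Interval [simp]:
  fixes l u :: real
  assumes "l \<le> u"
  shows "lower (Interval (l, u)) = l" "upper (Interval (l, u)) = u"
  using assms by (simp_all add: lower.rep_eq upper.rep_eq Interval_inverse)

lemma set_of_subset_iff:
  fixes X Y :: "real interval"
  shows "set_of X \<subseteq> set_of Y \<longleftrightarrow> lower Y \<le> lower X \<and> upper X \<le> upper Y"
  by (simp add: set_of_eq)

lemma is_valuation_iff:
  "is_valuation \<sigma> V \<longleftrightarrow> (\<forall>a\<in>\<sigma>. 0 \<le> lower (V H a) \<and> lower (V H a) \<le> lower (V T a)
     \<and> upper (V T a) \<le> upper (V H a) \<and> upper (V H a) \<le> 1)" (is "_ \<longleftrightarrow> ?R")
proof
  assume L: "is_valuation \<sigma> V"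
  show ?R
  proof
    fix a assume "a \<in> \<sigma>"
    then have "set_of (V H a) \<subseteq> {0..1}" "set_of (V T a) \<subseteq> set_of (V H a)"
      using L by (auto simp: is_valuation_def)
    then show "0 \<le> lower (V H a) \<and> lower (V H a) \<le> lower (V T a)
      \<and> upper (V T a) \<le> upper (V H a) \<and> upper (V H a) \<le> 1"
      by (simp add: set_of_eq)
  qed
next
  assume R: ?R
  have "set_of (V w a) \<subseteq> {0..1}" if "a \<in> \<sigma>" for w a
    using R that by (cases w) (fastforce simp: set_of_eq)+
  then show "is_valuation \<sigma> V"
    using R by (auto simp: is_valuation_def set_of_subset_iff)
qed

lemma op_mono:
  assumes "fuzzy_conjunction f \<or> fuzzy_disjunction f"
    and "0 \<le> a" "a \<le> b" "b \<le> 1" "0 \<le> c" "c \<le> d" "d \<le> 1"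
  shows "0 \<le> f a c" "f a c \<le> f b d" "f b d \<le> 1"
proof -
  have u: "unit_operator f" and m1: "mono_on {0..1} (\<lambda>x. f x c)" and m2: "mono_on {0..1} (f b)"
    using assms by (auto simp: fuzzy_conjunction_def fuzzy_disjunction_def)
  show "0 \<le> f a c" "f b d \<le> 1"
    using u assms by (auto simp: unit_operator_def)
  have "f a c \<le> f b c" using m1 assms by (auto simp: monotone_on_def)
  also have "\<dots> \<le> f b d" using m2 assms by (auto simp: monotone_on_def)
  finally show "f a c \<le> f b d" .
qed

lemma imp_mono:
  assumes "fuzzy_implication f"
    and "0 \<le> b" "b \<le> a" "a \<le> 1" "0 \<le> c" "c \<le> d" "d \<le> 1"
  shows "0 \<le> f a c" "f a c \<le> f b d" "f b d \<le> 1"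
proof -
  have u: "unit_operator f" and m1: "antimono_on {0..1} (\<lambda>x. f x c)" and m2: "mono_on {0..1} (f b)"
    using assms by (auto simp: fuzzy_implication_def)
  show "0 \<le> f a c" "f b d \<le> 1"
    using u assms by (auto simp: unit_operator_def)
  have "f a c \<le> f b c" using m1 assms by (auto simp: monotone_on_def)
  also have "\<dots> \<le> f b d" using m2 assms by (auto simp: monotone_on_def)
  finally show "f a c \<le> f b d" .
qed

lemma binop_bounds:
  fixes X X' Y Y' :: "real interval"
  assumes f: "fuzzy_conjunction f \<or> fuzzy_disjunction f"
    and "0 \<le> lower X" "lower X \<le> lower X'" "upper X' \<le> upper X" "upper X \<le> 1"
    and "0 \<le> lower Y" "lower Y \<le> lower Y'" "upper Y' \<le> upper Y" "upper Y \<le> 1"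
  shows "0 \<le> f (lower X) (lower Y)" "f (lower X) (lower Y) \<le> f (lower X') (lower Y')"
    "f (upper X') (upper Y') \<le> f (upper X) (upper Y)" "f (upper X) (upper Y) \<le> 1"
    "f (lower X) (lower Y) \<le> f (upper X) (upper Y)"
    "f (lower X') (lower Y') \<le> f (upper X') (upper Y')"
proof -
  have *: "lower X \<le> upper X" "lower X' \<le> upper X'" "lower Y \<le> upper Y" "lower Y' \<le> upper Y'"
    by simp_all
  show "0 \<le> f (lower X) (lower Y)"
    by (rule op_mono(1)[OF f, where b = 1 and d = 1]) (use assms(2-) * in linarith)+
  show "f (upper X) (upper Y) \<le> 1"
    by (rule op_mono(3)[OF f, where a = 0 and c = 0]) (use assms(2-) * in linarith)+
  show "f (lower X) (lower Y) \<le> f (lower X') (lower Y')"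
    "f (upper X') (upper Y') \<le> f (upper X) (upper Y)"
    "f (lower X) (lower Y) \<le> f (upper X) (upper Y)"
    "f (lower X') (lower Y') \<le> f (upper X') (upper Y')"
    by (rule op_mono(2)[OF f]; use assms(2-) * in linarith)+
qed

lemma val_bounds:
  assumes "is_valuation \<sigma> V" "fuzzy_formula \<sigma> F"
  shows "0 \<le> lower (val V H F) \<and> lower (val V H F) \<le> lower (val V T F)
    \<and> upper (val V T F) \<le> upper (val V H F) \<and> upper (val V H F) \<le> 1"
  using assms(2)
proof (induction F)
  case (Atom a)
  then show ?case using assms(1) by (simp add: is_valuation_iff)
next
  case (SNeg a)
  then show ?case using assms(1) by (simp add: is_valuation_iff)
next
  case (Const c)
  then show ?case by simp
next
  case (Neg F)
  then have "lower (val V T F) \<le> upper (val V T F)" "upper (val V T F) \<le> upper (val V H F)"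
    "upper (val V H F) \<le> 1" "lower (val V H F) \<le> lower (val V T F)" "0 \<le> lower (val V H F)"
    by auto
  moreover from this have "lower (val V T F) \<le> 1" by linarith
  ultimately show ?case by simp
next
  case (Conj f F G)
  have f: "fuzzy_conjunction f \<or> fuzzy_disjunction f" using Conj.prems by simp
  have "0 \<le> lower (val V H F)" "lower (val V H F) \<le> lower (val V T F)"
     "upper (val V T F) \<le> upper (val V H F)" "upper (val V H F) \<le> 1"
     "0 \<le> lower (val V H G)" "lower (val V H G) \<le> lower (val V T G)"
     "upper (val V T G) \<le> upper (val V H G)" "upper (val V H G) \<le> 1"
    using Conj by auto
  then show ?case
    using binop_bounds[OF f, of "val V H F" "val V T F" "val V H G" "val V T G"] by simp
next
  case (Disj f F G)
  have f: "fuzzy_conjunction f \<or> fuzzy_disjunction f" using Disj.prems by simp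
  have "0 \<le> lower (val V H F)" "lower (val V H F) \<le> lower (val V T F)"
     "upper (val V T F) \<le> upper (val V H F)" "upper (val V H F) \<le> 1"
     "0 \<le> lower (val V H G)" "lower (val V H G) \<le> lower (val V T G)"
     "upper (val V T G) \<le> upper (val V H G)" "upper (val V H G) \<le> 1"
    using Disj by auto
  then show ?case
    using binop_bounds[OF f, of "val V H F" "val V T F" "val V H G" "val V T G"] by simp
next
  case (Imp f F G)
  have f: "fuzzy_implication f" using Imp.prems by simp
  have FG: "0 \<le> lower (val V H F)" "lower (val V H F) \<le> lower (val V T F)"
     "upper (val V T F) \<le> upper (val V H F)" "upper (val V H F) \<le> 1"
     "0 \<le> lower (val V H G)" "lower (val V H G) \<le> lower (val V T G)"
     "upper (val V T G) \<le> upper (val V H G)" "upper (val V H G) \<le> 1"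
    using Imp by auto
  have *: "lower (val V T F) \<le> upper (val V T F)" "lower (val V T G) \<le> upper (val V T G)"
    "lower (val V H G) \<le> upper (val V H G)"
    by simp_all
  note M = imp_mono[OF f]
  have 1: "f (lower (val V T F)) (lower (val V T G)) \<le> f (lower (val V T F)) (upper (val V T G))"
    by (rule M) (use FG * in linarith)+
  have 2: "f (lower (val V H F)) (lower (val V H G)) \<le> f (lower (val V H F)) (upper (val V H G))"
    by (rule M) (use FG * in linarith)+
  have 3: "f (lower (val V T F)) (upper (val V T G)) \<le> f (lower (val V H F)) (upper (val V H G))"
    by (rule M) (use FG * in linarith)+
  have 4: "0 \<le> f (lower (val V T F)) (lower (val V T G))" "0 \<le> f (lower (val V H F)) (lower (val V H G))"
    by (rule M(1)[where b = 0 and d = 1]; use FG * in linarith)+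
  have 5: "f (lower (val V H F)) (upper (val V H G)) \<le> 1"
    by (rule M(3)[where a = 1 and c = 0]) (use FG * in linarith)+
  have 6: "min (f (lower (val V H F)) (lower (val V H G))) (f (lower (val V T F)) (lower (val V T G)))
      \<le> f (lower (val V H F)) (upper (val V H G))"
    using 2 by linarith
  show ?case
    using 1 3 4 5 6 by simp
qed

text \<open>The arguments of \<open>Interval\<close> in the clauses of \<^const>\<open>val\<close> are in order.\<close>

lemma bounds_val:
  assumes V: "is_valuation \<sigma> V" and F: "fuzzy_formula \<sigma> F" and G: "fuzzy_formula \<sigma> G"
  shows "1 - upper (V w a) \<le> 1 - lower (V w a)"
    and "1 - lower (val V T F) \<le> 1 - lower (val V H F)"
    and "fuzzy_conjunction f \<or> fuzzy_disjunction f \<Longrightarrow>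
      f (lower (val V w F)) (lower (val V w G)) \<le> f (upper (val V w F)) (upper (val V w G))"
    and "fuzzy_implication f \<Longrightarrow>
      f (lower (val V w F)) (lower (val V w G)) \<le> f (lower (val V w F)) (upper (val V w G))"
proof -
  have b: "0 \<le> lower (val V w F)" "upper (val V w F) \<le> 1" "0 \<le> lower (val V w G)" "upper (val V w G) \<le> 1"
    using val_bounds[OF V F] val_bounds[OF V G] by (cases w; simp)+
  have l: "lower (val V w F) \<le> 1"
    by (rule order_trans[OF lower_le_upper b(2)])
  show "1 - upper (V w a) \<le> 1 - lower (V w a)" by simp
  show "1 - lower (val V T F) \<le> 1 - lower (val V H F)" using val_bounds[OF V F] by simp
  show "f (lower (val V w F)) (lower (val V w G)) \<le> f (upper (val V w F)) (upper (val V w G))"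
    if "fuzzy_conjunction f \<or> fuzzy_disjunction f"
    using b by (intro op_mono(2)[OF that]) auto
  show "f (lower (val V w F)) (lower (val V w G)) \<le> f (lower (val V w F)) (upper (val V w G))"
    if "fuzzy_implication f"
    using b l by (intro imp_mono(2)[OF that]) auto
qed

end

theory Submission
  imports Defs
begin

text \<open>
  The lower bound of a formula depends only on the lower bounds of its atoms \<open>p\<close> and of its
  strongly negated atoms \<open>\<sim> p\<close>, the latter being \<open>1 - V\<^sup>+(p)\<close>. Treating \<open>\<sim> p\<close> as an atom
  \<open>np\<close> therefore does not change whether a valuation is a model. The added conjuncts are satisfied
  exactly when \<open>W\<^sup>-(t,p) + W\<^sup>-(t,np) \<le> 1\<close>, which always holds for \<open>W = nneg(V)\<close>. A valuation below
  \<open>nneg(V)\<close> has all its upper bounds equal to \<open>1\<close> and smaller lower bounds, so that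
  \<open>[W\<^sup>-(p), 1 - W\<^sup>-(np)]\<close> is again a valuation, below \<open>V\<close>; hence minimality transfers both ways.
\<close>

lemma fuzzy_conjunction_min: "fuzzy_conjunction min"
  by (auto simp: fuzzy_conjunction_def unit_operator_def monotone_on_def min_def)

lemma fuzzy_conjunction_luk: "fuzzy_conjunction conj_luk"
  by (auto simp: fuzzy_conjunction_def unit_operator_def monotone_on_def conj_luk_def max_def)

lemma fuzzy_formula_elim_sneg:
  "fuzzy_formula \<sigma> F \<Longrightarrow> fuzzy_formula (\<sigma> <+> \<sigma>) (elim_sneg F)"
  by (induction F) auto

lemma fuzzy_formula_big_conj_min:
  "(\<And>F. F \<in> set Fs \<Longrightarrow> fuzzy_formula \<sigma> F) \<Longrightarrow> fuzzy_formula \<sigma> (big_conj_min Fs)"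
  by (induction Fs rule: big_conj_min.induct) (auto simp: fuzzy_conjunction_min)

context
  fixes \<sigma> :: "'a set" and V :: "'a valuation"
  assumes V: "is_valuation \<sigma> V"
begin

lemma lower_val_le_1:
  assumes "fuzzy_formula \<sigma> F"
  shows "lower (val V w F) \<le> 1"
proof -
  have "upper (val V w F) \<le> 1" using val_bounds[OF V assms] by (cases w) auto
  then show ?thesis by (rule order_trans[OF lower_le_upper])
qed

text \<open>\<open>lower (Interval (l, u))\<close> is known to be \<open>l\<close> only if
  \<open>l <= u\<close>; this and the next three lemmas settle that side condition. Together they
  give lower bounds a recursion that consults upper bounds at \<open>SNeg\<close> only.\<close>

lemma lower_val_Neg:
  assumes "fuzzy_formula \<sigma> F"
  shows "lower (val V w (Neg F)) = 1 - lower (val V T F)"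
  using val_bounds[OF V assms] by (cases w) simp_all

lemma lower_val_Conj:
  assumes "fuzzy_formula \<sigma> (Conj f F G)"
  shows "lower (val V w (Conj f F G)) = f (lower (val V w F)) (lower (val V w G))"
  using bounds_val(3)[OF V] assms by simp

lemma lower_val_Disj:
  assumes "fuzzy_formula \<sigma> (Disj f F G)"
  shows "lower (val V w (Disj f F G)) = f (lower (val V w F)) (lower (val V w G))"
  using bounds_val(3)[OF V] assms by simp

lemma lower_val_Imp:
  assumes "fuzzy_formula \<sigma> (Imp f F G)"
  shows "lower (val V T (Imp f F G)) = f (lower (val V T F)) (lower (val V T G))"
    and "lower (val V H (Imp f F G)) =
      min (f (lower (val V H F)) (lower (val V H G))) (f (lower (val V T F)) (lower (val V T G)))"
  \<comment> \<open>At \<open>H\<close> the first argument of the minimum alone already lies below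
    the upper bound.\<close>
  using bounds_val(4)[OF V, of F G f] assms by (simp_all add: min.coboundedI1)

lemma lower_val_big_conj_min_eq_1_iff:
  "(\<And>F. F \<in> set Fs \<Longrightarrow> fuzzy_formula \<sigma> F) \<Longrightarrow>
    lower (val V w (big_conj_min Fs)) = 1 \<longleftrightarrow> (\<forall>F\<in>set Fs. lower (val V w F) = 1)"
proof (induction Fs rule: big_conj_min.induct)
  case (3 F G Fs)
  let ?R = "big_conj_min (G # Fs)"
  have F: "fuzzy_formula \<sigma> F" and R: "fuzzy_formula \<sigma> ?R"
    using "3.prems" fuzzy_formula_big_conj_min[of "G # Fs" \<sigma>] by auto
  have "lower (val V w (Conj min F ?R)) = min (lower (val V w F)) (lower (val V w ?R))"
    using F R by (intro lower_val_Conj) (simp add: fuzzy_conjunction_min)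
  \<comment> \<open>Both values are at most 1, so their minimum is 1 only when each is.\<close>
  then have "lower (val V w (Conj min F ?R)) = 1 \<longleftrightarrow>
      lower (val V w F) = 1 \<and> lower (val V w ?R) = 1"
    using lower_val_le_1[OF F, of w] lower_val_le_1[OF R, of w] by (auto simp: min_def)
  then show ?case using 3 by simp
qed simp_all

end

lemma is_valuation_bounds:
  assumes "is_valuation \<sigma> V" "a \<in> \<sigma>"
  shows "0 \<le> lower (V w a)" "upper (V w a) \<le> 1" "lower (V w a) \<le> 1"
proof -
  show "0 \<le> lower (V w a)" "upper (V w a) \<le> 1"
    using assms by (cases w; fastforce simp: is_valuation_iff)+
  then show "lower (V w a) \<le> 1" using lower_le_upper[of "V w a"] by linarith
qed

text \<open>Constraining lower bounds of \<open>W\<close> is enough to fix the lower bounds of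
  formulas without \<open>SNeg\<close>. Being a relation, it covers \<open>nneg_valuation V\<close>
  and also competitors \<open>W\<close> not given in that form.\<close>

definition matching :: "'a set \<Rightarrow> 'a valuation \<Rightarrow> ('a + 'a) valuation \<Rightarrow> bool" where
  "matching \<sigma> V W \<longleftrightarrow> (\<forall>w. \<forall>p\<in>\<sigma>.
     lower (W w (Inl p)) = lower (V w p) \<and> lower (W w (Inr p)) = 1 - upper (V w p))"

text \<open>Both sides obey the same recursion on lower bounds, and \<open>matching\<close> makes
  the base cases \<open>Atom\<close> and \<open>SNeg\<close> agree.\<close>

lemma lower_val_elim_sneg:
  assumes V: "is_valuation \<sigma> V" and W: "is_valuation (\<sigma> <+> \<sigma>) W"
    and VW: "matching \<sigma> V W" and F: "fuzzy_formula \<sigma> F"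
  shows "lower (val W w (elim_sneg F)) = lower (val V w F)"
  using F
\<comment> \<open>The world is generalised because \<open>Neg\<close> and \<open>Imp\<close> at
  \<open>H\<close> refer to \<open>T\<close>.\<close>
proof (induction F arbitrary: w)
  case (Neg F)
  then show ?case
    using lower_val_Neg[OF V, of F] lower_val_Neg[OF W, of "elim_sneg F"]
    by (simp add: fuzzy_formula_elim_sneg)
next
  case (Conj f F G)
  then show ?case
    using lower_val_Conj[OF V, of f F G] lower_val_Conj[OF W, of f "elim_sneg F" "elim_sneg G"]
    by (simp add: fuzzy_formula_elim_sneg del: val.simps)
next
  case (Disj f F G)
  then show ?case
    using lower_val_Disj[OF V, of f F G] lower_val_Disj[OF W, of f "elim_sneg F" "elim_sneg G"]
    by (simp add: fuzzy_formula_elim_sneg del: val.simps)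
next
  case (Imp f F G)
  then show ?case
    using lower_val_Imp[OF V, of f F G] lower_val_Imp[OF W, of f "elim_sneg F" "elim_sneg G"]
    by (cases w) (simp_all add: fuzzy_formula_elim_sneg del: val.simps)
qed (use VW in \<open>auto simp: matching_def\<close>)

lemma is_model_nneg_iff:
  assumes ps: "set ps = \<sigma>" and F: "fuzzy_formula \<sigma> F" and V: "is_valuation \<sigma> V"
    and W: "is_valuation (\<sigma> <+> \<sigma>) W" and VW: "matching \<sigma> V W"
  shows "is_model (\<sigma> <+> \<sigma>) (nneg ps F) W \<longleftrightarrow> is_model \<sigma> F V"
proof -
  let ?C = "\<lambda>p. Conj conj_luk (Atom (Inl p)) (Atom (Inr p)) :: ('a + 'a) form"
  let ?B = "big_conj_min (map (\<lambda>p. Neg (?C p)) ps)"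
  have C: "fuzzy_formula (\<sigma> <+> \<sigma>) (?C p)" if "p \<in> \<sigma>" for p
    using that by (auto simp: fuzzy_conjunction_luk)
  have E: "fuzzy_formula (\<sigma> <+> \<sigma>) (elim_sneg F)"
    using F by (rule fuzzy_formula_elim_sneg)
  have B: "fuzzy_formula (\<sigma> <+> \<sigma>) ?B"
    by (rule fuzzy_formula_big_conj_min) (use ps C in auto)
  have "lower (val W H (Neg (?C p))) = 1" if p: "p \<in> \<sigma>" for p
  proof -
    have "lower (val W T (?C p)) = conj_luk (lower (V T p)) (1 - upper (V T p))"
      using lower_val_Conj[OF W C[OF p]] VW p by (simp add: matching_def del: val.simps(4))
    \<comment> \<open>The interval \<open>V T p\<close> is nonempty, so the two arguments add up to
      at most 1.\<close>
    also have "\<dots> = 0"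
      using lower_le_upper[of "V T p"] by (simp add: conj_luk_def)
    finally show ?thesis by (simp only: lower_val_Neg[OF W C[OF p]])
  qed
  then have "lower (val W H ?B) = 1"
    using ps C by (subst lower_val_big_conj_min_eq_1_iff[OF W]) (auto simp del: val.simps)
  moreover have "lower (val W H (nneg ps F)) = min (lower (val W H (elim_sneg F))) (lower (val W H ?B))"
    unfolding nneg_def
    by (rule lower_val_Conj[OF W]) (simp add: fuzzy_conjunction_min E B)
  ultimately have "lower (val W H (nneg ps F)) = lower (val V H F)"
    using lower_val_elim_sneg[OF V W VW F] lower_val_le_1[OF V F, of H] by simp
  then show ?thesis using V W by (simp add: is_model_def)
qed

lemma bounds_nneg_valuation:
  assumes "is_valuation \<sigma> V" "p \<in> \<sigma>"
  shows "lower (nneg_valuation V w (Inl p)) = lower (V w p)"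
    and "lower (nneg_valuation V w (Inr p)) = 1 - upper (V w p)"
    and "upper (nneg_valuation V w (Inl p)) = 1"
    and "upper (nneg_valuation V w (Inr p)) = 1"
proof -
  \<comment> \<open>Needed for \<open>1 - upper (V w p) <= 1\<close>, the order of the interval at
    \<open>Inr p\<close>.\<close>
  have "0 \<le> upper (V w p)"
    using is_valuation_bounds(1)[OF assms, of w] lower_le_upper[of "V w p"] by linarith
  then show "lower (nneg_valuation V w (Inl p)) = lower (V w p)"
    "lower (nneg_valuation V w (Inr p)) = 1 - upper (V w p)"
    "upper (nneg_valuation V w (Inl p)) = 1"
    "upper (nneg_valuation V w (Inr p)) = 1"
    using is_valuation_bounds(3)[OF assms, of w] by (simp_all add: nneg_valuation_def)
qed

lemma is_valuation_nneg_valuation: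
  assumes "is_valuation \<sigma> V"
  shows "is_valuation (\<sigma> <+> \<sigma>) (nneg_valuation V)"
  using assms bounds_nneg_valuation[OF assms]
  by (auto simp: is_valuation_iff)

lemma matching_nneg_valuation: "is_valuation \<sigma> V \<Longrightarrow> matching \<sigma> V (nneg_valuation V)"
  by (simp add: matching_def bounds_nneg_valuation)

text \<open>\<open>Inl p\<close> keeps the lower and \<open>Inr p\<close> the upper bound, so the
  pair determines \<open>V w p\<close>. Separate worlds \<open>w\<close> and \<open>w'\<close> also
  allow comparing one valuation at \<open>H\<close> and \<open>T\<close>.\<close>

lemma nneg_valuation_eq_iff:
  assumes "is_valuation \<sigma> V" "is_valuation \<sigma> V'" "p \<in> \<sigma>"
  shows "nneg_valuation V w (Inl p) = nneg_valuation V' w' (Inl p)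
      \<and> nneg_valuation V w (Inr p) = nneg_valuation V' w' (Inr p) \<longleftrightarrow> V w p = V' w' p"
  by (auto simp: interval_eq_iff bounds_nneg_valuation[OF assms(1,3)]
      bounds_nneg_valuation[OF assms(2,3)])

text \<open>Widening an interval decreases both its lower bound and one minus its upper bound;
  strictness survives by injectivity of the translation.\<close>

lemma val_prec_nneg_valuation:
  assumes V: "is_valuation \<sigma> V" and V': "is_valuation \<sigma> V'" and prec: "val_prec \<sigma> V' V"
  shows "val_prec (\<sigma> <+> \<sigma>) (nneg_valuation V') (nneg_valuation V)"
proof -
  have "val_preceq (\<sigma> <+> \<sigma>) (nneg_valuation V') (nneg_valuation V)"
    using prec
    by (auto simp: val_prec_def val_preceq_def set_of_subset_iff interval_eq_iff
        bounds_nneg_valuation[OF V] bounds_nneg_valuation[OF V'])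
  moreover obtain w p where "p \<in> \<sigma>" "V' w p \<noteq> V w p"
    using prec by (auto simp: val_prec_def)
  then have "\<exists>x\<in>\<sigma> <+> \<sigma>. nneg_valuation V' w x \<noteq> nneg_valuation V w x"
    using nneg_valuation_eq_iff[OF V' V] by (metis InlI InrI)
  ultimately show ?thesis by (auto simp: val_prec_def)
qed

lemma val_prec_nneg_valuationE:
  assumes V: "is_valuation \<sigma> V" and W: "is_valuation (\<sigma> <+> \<sigma>) W"
    and prec: "val_prec (\<sigma> <+> \<sigma>) W (nneg_valuation V)"
  obtains V' where "is_valuation \<sigma> V'" "matching \<sigma> V' W" "val_prec \<sigma> V' V"
proof
  \<comment> \<open>This inverts the translation: an upper bound is recovered as the complement of
    the lower bound at \<open>Inr p\<close>.\<close>
  define V' :: "'a valuation" where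
    "V' w p = Interval (lower (W w (Inl p)), 1 - lower (W w (Inr p)))" for w p
  note nV = bounds_nneg_valuation[OF V]
  have T: "W T (Inl p) = nneg_valuation V T (Inl p)" "W T (Inr p) = nneg_valuation V T (Inr p)"
    and H_le: "lower (W H (Inl p)) \<le> lower (V H p)" "lower (W H (Inr p)) \<le> 1 - upper (V H p)"
    and H_upper: "upper (W H (Inl p)) = 1" "upper (W H (Inr p)) = 1"
    if p: "p \<in> \<sigma>" for p
  proof -
    have le: "set_of (nneg_valuation V H x) \<subseteq> set_of (W H x)"
      and eq: "W T x = nneg_valuation V T x" if "x \<in> \<sigma> <+> \<sigma>" for x
      using prec that by (auto simp: val_prec_def val_preceq_def)
    show "W T (Inl p) = nneg_valuation V T (Inl p)" "W T (Inr p) = nneg_valuation V T (Inr p)"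
      using eq p by auto
    \<comment> \<open>For the upper bounds, containment forces at least 1 and \<open>W\<close> being
      a valuation at most 1.\<close>
    show "lower (W H (Inl p)) \<le> lower (V H p)" "lower (W H (Inr p)) \<le> 1 - upper (V H p)"
      "upper (W H (Inl p)) = 1" "upper (W H (Inr p)) = 1"
      using le[OF InlI[OF p]] le[OF InrI[OF p]] p is_valuation_bounds(2)[OF W InlI[OF p], of H]
        is_valuation_bounds(2)[OF W InrI[OF p], of H]
      by (auto simp: set_of_subset_iff nV)
  qed
  \<comment> \<open>At \<open>H\<close> the endpoints enclose the nonempty interval
    \<open>V H p\<close>; at \<open>T\<close> they are those of \<open>V T p\<close>.\<close>
  have "lower (W w (Inl p)) \<le> 1 - lower (W w (Inr p))" if p: "p \<in> \<sigma>" for w p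
  proof (cases w)
    case H
    show ?thesis unfolding H using lower_le_upper[of "V H p"] H_le[OF p] by linarith
  qed (simp add: T nV p)
  then have V': "lower (V' w p) = lower (W w (Inl p))" "upper (V' w p) = 1 - lower (W w (Inr p))"
    if "p \<in> \<sigma>" for w p
    using that by (simp_all add: V'_def)
  then show "matching \<sigma> V' W" by (simp add: matching_def)
  show "is_valuation \<sigma> V'"
    using W by (auto simp: is_valuation_iff V')
  have T': "V' T p = V T p" if "p \<in> \<sigma>" for p
    using that by (simp add: interval_eq_iff V' T nV)
  have "val_preceq \<sigma> V' V"
    using H_le T' by (force simp: val_preceq_def set_of_subset_iff V')
  moreover obtain w x where x: "x \<in> \<sigma> <+> \<sigma>" "W w x \<noteq> nneg_valuation V w x"
    using prec by (auto simp: val_prec_def)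
  have w: "w = H" using x T by (cases w) auto
  \<comment> \<open>Upper bounds at \<open>H\<close> are 1 on both sides, so the disagreement at
    \<open>x\<close> is one of lower bounds and shows up in \<open>V'\<close>.\<close>
  have "\<exists>p\<in>\<sigma>. V' H p \<noteq> V H p"
    using x unfolding w by (force simp: interval_eq_iff nV V' H_upper)
  ultimately show "val_prec \<sigma> V' V" by (auto simp: val_prec_def)
qed

lemma h_minimal_model_nneg_iff:
  assumes ps: "set ps = \<sigma>" and F: "fuzzy_formula \<sigma> F" and V: "is_valuation \<sigma> V"
  shows "h_minimal_model (\<sigma> <+> \<sigma>) (nneg ps F) (nneg_valuation V) \<longleftrightarrow> h_minimal_model \<sigma> F V"
proof -
  note model_iff = is_model_nneg_iff[OF ps F]
  have nneg_model: "is_model (\<sigma> <+> \<sigma>) (nneg ps F) (nneg_valuation U) \<longleftrightarrow> is_model \<sigma> F U"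
    if "is_valuation \<sigma> U" for U
    using that by (intro model_iff is_valuation_nneg_valuation matching_nneg_valuation)
  have "(\<exists>W. is_model (\<sigma> <+> \<sigma>) (nneg ps F) W \<and> val_prec (\<sigma> <+> \<sigma>) W (nneg_valuation V))
      \<longleftrightarrow> (\<exists>V'. is_model \<sigma> F V' \<and> val_prec \<sigma> V' V)" (is "?L \<longleftrightarrow> ?R")
  proof
    assume ?L
    then obtain W where W: "is_model (\<sigma> <+> \<sigma>) (nneg ps F) W"
      "val_prec (\<sigma> <+> \<sigma>) W (nneg_valuation V)" by blast
    then have "is_valuation (\<sigma> <+> \<sigma>) W" by (simp add: is_model_def)
    \<comment> \<open>The extracted valuation is only known to match \<open>W\<close>, hence
      \<open>model_iff\<close> rather than its special case \<open>nneg_model\<close>.\<close>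
    with W V show ?R by (metis val_prec_nneg_valuationE model_iff)
  next
    assume ?R
    then obtain V' where V': "is_model \<sigma> F V'" "val_prec \<sigma> V' V" by blast
    then have "is_valuation \<sigma> V'" by (simp add: is_model_def)
    with V' V show ?L by (metis val_prec_nneg_valuation nneg_model)
  qed
  then show ?thesis by (simp add: h_minimal_model_def nneg_model V)
qed

theorem proposition3:
  fixes \<sigma> :: "'a set" and ps :: "'a list" and F :: "'a form" and V :: "'a valuation"
  assumes "finite \<sigma>" and "distinct ps" and "set ps = \<sigma>"
    and "fuzzy_formula \<sigma> F"
    and "is_valuation \<sigma> V"
  shows "equilibrium_model \<sigma> F V
    \<longleftrightarrow> equilibrium_model (\<sigma> <+> \<sigma>) (nneg ps F) (nneg_valuation V)"
proof -
  have "(\<forall>x\<in>\<sigma> <+> \<sigma>. nneg_valuation V H x = nneg_valuation V T x) \<longleftrightarrow> (\<forall>p\<in>\<sigma>. V H p = V T p)"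
    using nneg_valuation_eq_iff[OF assms(5,5)] by (auto; metis InlI InrI)
  then show ?thesis
    by (simp add: equilibrium_model_def h_minimal_model_nneg_iff[OF assms(3-5)])
qed

end
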